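(* Let $n,k \in \mathbb{Z}^+$ be such that $k \geq 2n$. Then $$\mathcal{H}^{k+1} \left( \mathcal{P}_{n+1,k} \cap \overline{B}_{k+1}(0,1) \right) < \mathcal{H}^{k+1} \left( \mathcal{P}_{n,k} \cap \overline{B}_{k+1} (0,1) \right).$$
   Context: For a positive integer $n$, let $\mathsf{M}_n^{\geq 0}$ denote the set of $n\times n$ real matrices with all entries nonnegative. Define $\mathcal{P}_n = \{ p \in \mathbb{R}[x] : p(A) \geq 0 \text{ for all } A \in \mathsf{M}_n^{\geq 0}\}$, where $p(A)\ge 0$ means that the matrix $p(A)$ is entrywise nonnegative, and $\mathcal{P}_{n,m} = \{ p \in \mathcal{P}_n : \deg(p) \leq m \}$ (the zero polynomial included). $\mathcal{P}_{n,k}$ is regarded as a subset of $\mathbb{R}^{k+1}$ by identifying a polynomial $\sum_{j=0}^k a_j x^j$ with its coefficient vector $(a_0,\dots,a_k)$. $\overline{B}_{k+1}(0,1)$ is the closed Euclidean unit ball in $\mathbb{R}^{k+1}$ centered at $0$, and $\mathcal{H}^{s}$ denotes $s$-dimensional Hausdorff measure. *)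

theory Defs
  imports
    "HOL-Analysis.Analysis"
    "HOL-Computational_Algebra.Polynomial"
    "Jordan_Normal_Form.Matrix"
begin

section \<open>Polynomials preserving entrywise nonnegative matrices\<close>

definition nonneg_matrices :: "nat \<Rightarrow> real mat set" where
  "nonneg_matrices n = {A \<in> carrier_mat n n. \<forall>i<n. \<forall>j<n. A $$ (i, j) \<ge> 0}"

text \<open>The matrix \<open>p(A) = (\<Sum>m. p\<^sub>m A\<^sup>m)\<close>, with \<open>A\<^sup>0\<close> the identity matrix; the sum is written
  entrywise.\<close>

definition poly_mat :: "real poly \<Rightarrow> real mat \<Rightarrow> real mat" where
  "poly_mat p A =
     mat (dim_row A) (dim_col A) (\<lambda>(i, j). \<Sum>m\<le>degree p. coeff p m * (A ^\<^sub>m m) $$ (i, j))"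

definition preservers :: "nat \<Rightarrow> real poly set" where
  "preservers n = {p. \<forall>A \<in> nonneg_matrices n. poly_mat p A \<in> nonneg_matrices n}"

text \<open>The zero polynomial has degree 0 in the library, so it satisfies every degree bound.\<close>

definition preservers_deg :: "nat \<Rightarrow> nat \<Rightarrow> real poly set" where
  "preservers_deg n m = {p \<in> preservers n. degree p \<le> m}"


section \<open>Euclidean space of variable dimension\<close>

text \<open>As in \<^const>\<open>Euclidean_space\<close>, \<open>\<real>\<^sup>d\<close> consists of the real sequences vanishing from index
  \<open>d\<close> on. Thus \<^const>\<open>coeff\<close> itself identifies the polynomials of degree at most \<open>k\<close> with
  the points of \<open>\<real>\<^sup>d\<close> for \<open>d = k + 1\<close>.\<close>

definition euclidean_metric_dim :: "nat \<Rightarrow> (nat \<Rightarrow> real) metric" where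
  "euclidean_metric_dim d =
     metric (topspace (Euclidean_space d), \<lambda>x y. L2_set (\<lambda>i. x i - y i) {..<d})"

lemma Metric_space_euclidean_dim:
  "Metric_space (topspace (Euclidean_space d)) (\<lambda>x y. L2_set (\<lambda>i. x i - y i) {..<d})"
proof
  fix x y :: "nat \<Rightarrow> real"
  show "0 \<le> L2_set (\<lambda>i. x i - y i) {..<d}"
    by (rule L2_set_nonneg)
  show "L2_set (\<lambda>i. x i - y i) {..<d} = L2_set (\<lambda>i. y i - x i) {..<d}"
    by (simp add: L2_set_def power2_commute)
next
  fix x y :: "nat \<Rightarrow> real"
  assume "x \<in> topspace (Euclidean_space d)" "y \<in> topspace (Euclidean_space d)"
  then show "L2_set (\<lambda>i. x i - y i) {..<d} = 0 \<longleftrightarrow> x = y"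
    by (auto simp: L2_set_eq_0_iff topspace_Euclidean_space fun_eq_iff)
       (metis lessThan_iff not_less)
next
  fix x y z :: "nat \<Rightarrow> real"
  show "L2_set (\<lambda>i. x i - z i) {..<d} \<le>
        L2_set (\<lambda>i. x i - y i) {..<d} + L2_set (\<lambda>i. y i - z i) {..<d}"
    using L2_set_triangle_ineq[of "\<lambda>i. x i - y i" "\<lambda>i. y i - z i" "{..<d}"] by simp
qed

lemma mspace_euclidean_metric_dim [simp]:
  "mspace (euclidean_metric_dim d) = topspace (Euclidean_space d)"
  by (simp add: euclidean_metric_dim_def Metric_space.mspace_metric Metric_space_euclidean_dim)

lemma mdist_euclidean_metric_dim [simp]:
  "mdist (euclidean_metric_dim d) = (\<lambda>x y. L2_set (\<lambda>i. x i - y i) {..<d})"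
  by (simp add: euclidean_metric_dim_def Metric_space.mdist_metric Metric_space_euclidean_dim)


section \<open>Hausdorff measure\<close>

definition mdiameter :: "'a metric \<Rightarrow> 'a set \<Rightarrow> ennreal" where
  "mdiameter m U = (SUP (x, y) \<in> U \<times> U. ennreal (mdist m x y))"

text \<open>\<open>diam(U)\<^sup>s\<close> for \<open>U\<close> of finite diameter, with the usual conventions for \<open>s = 0\<close>: the empty set
  contributes \<open>0\<close> and every nonempty set contributes \<open>1\<close> (whereas \<open>0 powr 0 = 0\<close>).\<close>

definition diam_powr :: "'a metric \<Rightarrow> real \<Rightarrow> 'a set \<Rightarrow> ennreal" where
  "diam_powr m s U =
     (if U = {} then 0 else if s = 0 then 1 else ennreal (enn2real (mdiameter m U) powr s))"

definition delta_covers :: "'a metric \<Rightarrow> real \<Rightarrow> 'a set \<Rightarrow> (nat \<Rightarrow> 'a set) set" where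
  "delta_covers m \<delta> E =
     {U. (\<forall>i. U i \<subseteq> mspace m \<and> mdiameter m (U i) \<le> ennreal \<delta>) \<and> E \<subseteq> (\<Union>i. U i)}"

definition hausdorff_content :: "'a metric \<Rightarrow> real \<Rightarrow> real \<Rightarrow> 'a set \<Rightarrow> ennreal" where
  "hausdorff_content m s \<delta> E = (INF U \<in> delta_covers m \<delta> E. \<Sum>i. diam_powr m s (U i))"

text \<open>The supremum over \<open>\<delta> > 0\<close> is the limit as \<open>\<delta> \<rightarrow> 0\<close>, since the content is antitone in \<open>\<delta>\<close>.
  No normalising constant is used: some authors multiply by a positive finite constant depending
  only on \<open>s\<close>, which does not affect comparisons between measures of the same dimension.\<close>

definition hausdorff_measure :: "'a metric \<Rightarrow> real \<Rightarrow> 'a set \<Rightarrow> ennreal" where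
  "hausdorff_measure m s E = (SUP \<delta> \<in> {0<..}. hausdorff_content m s \<delta> E)"

end

theory Submission
  imports Defs
begin

text \<open>The two sets are nested, because an \<open>n \<times> n\<close> matrix can be padded with a zero row and a zero
  column. They are told apart by the coefficient of \<open>x\<^sup>n\<close>.

  For \<open>(n + 1) \<times> (n + 1)\<close> matrices this coefficient must be nonnegative: it is the top right entry of
  \<open>p(N)\<close> for the nilpotent shift \<open>N\<close> (\<open>preservers_coeff_nonneg\<close>).

  For \<open>n \<times> n\<close> matrices it may be slightly negative, provided that the other coefficients up
  to the degree bound are at least some positive constant; this is where \<open>k \<ge> 2 n\<close> is needed.
  Indeed an entry of \<open>A\<^sup>n\<close> is the sum of the weights of the walks with \<open>n\<close> steps between two
  vertices out of \<open>n\<close>. Such a walk visits some vertex twice, hence contains a cycle, of length \<open>c\<close> and weight \<open>C\<close>, say. Deleting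
  this cycle gives a walk with \<open>n - c\<close> steps, traversing it twice gives one with \<open>n + c \<le> 2 n\<close> steps,
  and as \<open>C \<le> 1 + C\<^sup>2\<close> the weight of the original walk is at most the sum of the two new ones. So a
  multiple of \<open>A\<^sup>n\<close> is dominated by the sum of the other powers of exponent at most \<open>2 n\<close>
  (\<open>pow_mat_dominated\<close>, \<open>preserver_with_negative_coeff\<close>).

  Consequently the larger set contains a nondegenerate box of coefficient vectors whose \<open>n\<close>-th
  coordinate is at most some \<open>- \<gamma> < 0\<close>. The box has distance at least \<open>\<gamma>\<close> from the smaller set, and
  Hausdorff measure is additive on sets at positive distance, of which superadditivity
  (\<open>hausdorff_measure_separated\<close>) suffices here. The strict inequality follows since the box has
  positive measure (\<open>hausdorff_measure_box_pos\<close>) and the smaller set, being bounded, has finite measure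
  (\<open>hausdorff_measure_cube_finite\<close>).\<close>


section \<open>Hausdorff measure of separated sets\<close>

lemma mdiameter_leI:
  assumes "\<And>x y. x \<in> U \<Longrightarrow> y \<in> U \<Longrightarrow> mdist m x y \<le> r"
  shows "mdiameter m U \<le> ennreal r"
  unfolding mdiameter_def by (rule SUP_least) (auto intro!: ennreal_leI assms)

lemma mdist_le_mdiameter:
  assumes "x \<in> U" "y \<in> U" "mdiameter m U < \<infinity>"
  shows "mdist m x y \<le> enn2real (mdiameter m U)"
proof -
  have "ennreal (mdist m x y) \<le> mdiameter m U"
    unfolding mdiameter_def using assms by (intro SUP_upper2[of "(x, y)"]) auto
  then have "enn2real (ennreal (mdist m x y)) \<le> enn2real (mdiameter m U)"
    using assms(3) by (intro enn2real_mono) (simp_all add: infinity_ennreal_def)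
  then show ?thesis by simp
qed

lemma mdiameter_empty [simp]: "mdiameter m {} = 0"
  by (simp add: mdiameter_def bot_ennreal)

lemma diam_powr_empty [simp]: "diam_powr m s {} = 0"
  by (simp add: diam_powr_def)

lemma hausdorff_content_mono:
  "E \<subseteq> F \<Longrightarrow> hausdorff_content m s \<delta> E \<le> hausdorff_content m s \<delta> F"
  unfolding hausdorff_content_def by (rule INF_superset_mono) (auto simp: delta_covers_def)

lemma hausdorff_measure_mono:
  "E \<subseteq> F \<Longrightarrow> hausdorff_measure m s E \<le> hausdorff_measure m s F"
  unfolding hausdorff_measure_def by (intro SUP_mono) (blast intro: hausdorff_content_mono)

lemma hausdorff_content_antimono:
  assumes "\<delta> \<le> \<delta>'"
  shows "hausdorff_content m s \<delta>' E \<le> hausdorff_content m s \<delta> E"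
  unfolding hausdorff_content_def
  by (rule INF_superset_mono) (use ennreal_leI[OF assms] in \<open>auto simp: delta_covers_def intro: order_trans\<close>)

lemma hausdorff_content_le_measure:
  "\<delta> > 0 \<Longrightarrow> hausdorff_content m s \<delta> E \<le> hausdorff_measure m s E"
  unfolding hausdorff_measure_def by (rule SUP_upper) simp

text \<open>A set of diameter below the gap between \<open>E\<close> and \<open>F\<close> meets at most one of the two, so the
  members of a cover of the union that serve to cover \<open>E\<close> are not those that serve to cover \<open>F\<close>.\<close>

lemma hausdorff_content_separated:
  assumes gap: "\<And>x y. x \<in> E \<Longrightarrow> y \<in> F \<Longrightarrow> \<gamma> \<le> mdist m x y" and "0 < \<delta>" "\<delta> < \<gamma>"
  shows "hausdorff_content m s \<delta> E + hausdorff_content m s \<delta> F \<le> hausdorff_content m s \<delta> (E \<union> F)"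
  unfolding hausdorff_content_def[of _ _ _ "E \<union> F"]
proof (rule INF_greatest)
  fix U assume U: "U \<in> delta_covers m \<delta> (E \<union> F)"
  define V where "V i = (if U i \<inter> E \<noteq> {} then U i else {})" for i
  define W where "W i = (if U i \<inter> F \<noteq> {} then U i else {})" for i
  have V: "V \<in> delta_covers m \<delta> E" and W: "W \<in> delta_covers m \<delta> F"
    using U by (auto simp: delta_covers_def V_def W_def; blast)+
  have disj: "U i \<inter> E = {} \<or> U i \<inter> F = {}" for i
  proof (rule ccontr)
    assume "\<not> ?thesis"
    then obtain x y where xy: "x \<in> U i" "x \<in> E" "y \<in> U i" "y \<in> F" by blast
    have le: "mdiameter m (U i) \<le> ennreal \<delta>" using U by (auto simp: delta_covers_def)
    then have "mdist m x y \<le> enn2real (mdiameter m (U i))"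
      using xy by (intro mdist_le_mdiameter) (auto simp: order_le_less_trans)
    also have "\<dots> \<le> \<delta>"
      using le \<open>0 < \<delta>\<close> by (simp add: enn2real_leI)
    finally show False using gap[OF xy(2,4)] \<open>\<delta> < \<gamma>\<close> by simp
  qed
  have "hausdorff_content m s \<delta> E + hausdorff_content m s \<delta> F
      \<le> (\<Sum>i. diam_powr m s (V i)) + (\<Sum>i. diam_powr m s (W i))"
    unfolding hausdorff_content_def by (intro add_mono INF_lower V W)
  also have "\<dots> = (\<Sum>i. diam_powr m s (V i) + diam_powr m s (W i))"
    by (rule suminf_add) auto
  also have "\<dots> \<le> (\<Sum>i. diam_powr m s (U i))"
    using disj by (intro suminf_le) (auto simp: V_def W_def)
  finally show "hausdorff_content m s \<delta> E + hausdorff_content m s \<delta> F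
      \<le> (\<Sum>i. diam_powr m s (U i))" .
qed

lemma hausdorff_measure_separated:
  assumes gap: "\<And>x y. x \<in> E \<Longrightarrow> y \<in> F \<Longrightarrow> \<gamma> \<le> mdist m x y" and "0 < \<gamma>"
  shows "hausdorff_measure m s E + hausdorff_measure m s F \<le> hausdorff_measure m s (E \<union> F)"
proof -
  have le: "hausdorff_content m s \<delta> E + hausdorff_content m s \<epsilon> F \<le> hausdorff_measure m s (E \<union> F)"
    if "\<delta> > 0" "\<epsilon> > 0" for \<delta> \<epsilon>
  proof -
    define \<eta> where "\<eta> = min (min \<delta> \<epsilon>) (\<gamma> / 2)"
    have \<eta>: "0 < \<eta>" "\<eta> \<le> \<delta>" "\<eta> \<le> \<epsilon>" "\<eta> < \<gamma>" using that \<open>0 < \<gamma>\<close> by (auto simp: \<eta>_def)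
    have "hausdorff_content m s \<delta> E + hausdorff_content m s \<epsilon> F
        \<le> hausdorff_content m s \<eta> E + hausdorff_content m s \<eta> F"
      by (intro add_mono hausdorff_content_antimono \<eta>)
    also have "\<dots> \<le> hausdorff_content m s \<eta> (E \<union> F)"
      using gap \<eta> by (intro hausdorff_content_separated[of E F \<gamma>])
    also have "\<dots> \<le> hausdorff_measure m s (E \<union> F)"
      using \<eta> by (intro hausdorff_content_le_measure)
    finally show ?thesis .
  qed
  have "hausdorff_measure m s E + hausdorff_measure m s F =
      (SUP \<delta>\<in>{0<..}. hausdorff_content m s \<delta> E + hausdorff_measure m s F)"
    unfolding hausdorff_measure_def[of m s E] by (rule ennreal_SUP_add_left[symmetric]) auto
  also have "\<dots> = (SUP \<delta>\<in>{0<..}. SUP \<epsilon>\<in>{0<..}.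
      hausdorff_content m s \<delta> E + hausdorff_content m s \<epsilon> F)"
    unfolding hausdorff_measure_def[of m s F] by (subst ennreal_SUP_add_right) auto
  also have "\<dots> \<le> hausdorff_measure m s (E \<union> F)"
    by (intro SUP_least le) auto
  finally show ?thesis .
qed


section \<open>Hausdorff measure in the dimension of the space\<close>

lemma abs_diff_le_L2_set:
  fixes x y :: "nat \<Rightarrow> real"
  assumes "i < d"
  shows "\<bar>x i - y i\<bar> \<le> L2_set (\<lambda>i. x i - y i) {..<d}"
  using member_le_L2_set[of "{..<d}" i "\<lambda>i. \<bar>x i - y i\<bar>"] assms by (simp add: L2_set_def)

lemma hausdorff_content_finite_cover:
  assumes "finite I" "E \<subseteq> (\<Union>f\<in>I. C f)" "0 < s" "0 \<le> r" "r \<le> \<delta>"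
    and C: "\<And>f. f \<in> I \<Longrightarrow> C f \<subseteq> mspace m" "\<And>f. f \<in> I \<Longrightarrow> mdiameter m (C f) \<le> ennreal r"
  shows "hausdorff_content m s \<delta> E \<le> of_nat (card I) * ennreal (r powr s)"
proof -
  obtain h where h: "bij_betw h {0..<card I} I"
    using ex_bij_betw_nat_finite[OF \<open>finite I\<close>] by blast
  define V where "V i = (if i < card I then C (h i) else {})" for i
  have hI: "h i \<in> I" if "i < card I" for i using bij_betwE[OF h] that by auto
  have "E \<subseteq> (\<Union>i. V i)"
  proof
    fix x assume "x \<in> E"
    then obtain f where "f \<in> I" "x \<in> C f" using assms by blast
    moreover obtain i where "i < card I" "f = h i"
      using bij_betw_imp_surj_on[OF h] \<open>f \<in> I\<close> by fastforce
    ultimately show "x \<in> (\<Union>i. V i)" by (auto simp: V_def)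
  qed
  moreover have "V i \<subseteq> mspace m \<and> mdiameter m (V i) \<le> ennreal \<delta>" for i
    using C hI order_trans[OF C(2)[OF hI] ennreal_leI[OF \<open>r \<le> \<delta>\<close>]] by (auto simp: V_def)
  ultimately have "V \<in> delta_covers m \<delta> E" by (auto simp: delta_covers_def)
  then have "hausdorff_content m s \<delta> E \<le> (\<Sum>i. diam_powr m s (V i))"
    unfolding hausdorff_content_def by (rule INF_lower)
  also have "\<dots> = (\<Sum>i<card I. diam_powr m s (V i))"
    by (rule suminf_finite) (auto simp: V_def)
  also have "\<dots> \<le> (\<Sum>i<card I. ennreal (r powr s))"
  proof (rule sum_mono)
    fix i assume "i \<in> {..<card I}"
    then have "enn2real (mdiameter m (V i)) \<le> r"
      using C(2)[OF hI] \<open>0 \<le> r\<close> by (simp add: V_def enn2real_leI)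
    then show "diam_powr m s (V i) \<le> ennreal (r powr s)"
      using \<open>0 < s\<close> by (auto simp: diam_powr_def intro!: ennreal_leI powr_mono2)
  qed
  finally show ?thesis by simp
qed

text \<open>A grid of mesh \<open>1 / N\<close> cuts the cube into at most \<open>(2 N + 1)\<^sup>d\<close> cells of diameter at most
  \<open>d / N\<close>, which bounds every content by \<open>(3 d)\<^sup>d\<close>.\<close>

lemma hausdorff_measure_cube_finite:
  assumes "d \<ge> 1"
  shows "hausdorff_measure (euclidean_metric_dim d) (real d)
           {x \<in> topspace (Euclidean_space d). \<forall>i<d. \<bar>x i\<bar> \<le> 1} < \<infinity>"
    (is "hausdorff_measure ?m ?s ?E < \<infinity>")
proof -
  have "hausdorff_content ?m ?s \<delta> ?E \<le> ennreal ((3 * real d) ^ d)" if "\<delta> > 0" for \<delta>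
  proof -
    obtain N :: nat where N: "real d / \<delta> < real N" using reals_Archimedean2 by blast
    have "0 < real d / \<delta>" using assms that by simp
    then have N0: "0 < real N" using N by linarith
    define r where "r = real d / real N"
    have r: "0 \<le> r" "r \<le> \<delta>" using N N0 that by (auto simp: r_def field_simps)
    define I where "I = (\<Pi>\<^sub>E i\<in>{..<d}. {- int N..int N})"
    define C where "C f = {x \<in> topspace (Euclidean_space d). \<forall>i<d. \<lfloor>x i * real N\<rfloor> = f i}"
      for f :: "nat \<Rightarrow> int"
    have cover: "?E \<subseteq> (\<Union>f\<in>I. C f)"
    proof
      fix x assume x: "x \<in> ?E"
      have "\<lfloor>x i * real N\<rfloor> \<in> {- int N..int N}" if "i < d" for i
      proof -
        have "\<bar>x i * real N\<bar> \<le> 1 * real N" unfolding abs_mult using x that by (intro mult_mono) auto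
        then have "- real N \<le> x i * real N" "x i * real N \<le> real N" by auto
        then show ?thesis by (auto simp: le_floor_iff floor_le_iff)
      qed
      then have "restrict (\<lambda>i. \<lfloor>x i * real N\<rfloor>) {..<d} \<in> I" by (auto simp: I_def)
      moreover have "x \<in> C (restrict (\<lambda>i. \<lfloor>x i * real N\<rfloor>) {..<d})"
        using x by (auto simp: C_def)
      ultimately show "x \<in> (\<Union>f\<in>I. C f)" by blast
    qed
    have diam: "mdiameter ?m (C f) \<le> ennreal r" for f
    proof (rule mdiameter_leI)
      fix x y assume xy: "x \<in> C f" "y \<in> C f"
      have "\<bar>x i - y i\<bar> \<le> 1 / real N" if "i < d" for i
      proof -
        have "\<lfloor>x i * real N\<rfloor> = \<lfloor>y i * real N\<rfloor>" using xy that by (auto simp: C_def)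
        then have "\<bar>x i * real N - y i * real N\<bar> \<le> 1" by linarith
        then have "\<bar>x i - y i\<bar> * real N \<le> 1" by (simp add: abs_mult flip: left_diff_distrib)
        then show ?thesis using N0 by (simp add: field_simps)
      qed
      then have "(\<Sum>i<d. \<bar>x i - y i\<bar>) \<le> (\<Sum>i<d. 1 / real N)" by (intro sum_mono) auto
      then show "mdist ?m x y \<le> r"
        using L2_set_le_sum_abs[of "\<lambda>i. x i - y i" "{..<d}"] by (simp add: r_def)
    qed
    have "finite I" by (auto simp: I_def intro: finite_PiE)
    then have "hausdorff_content ?m ?s \<delta> ?E \<le> of_nat (card I) * ennreal (r powr ?s)"
      using cover assms r diam by (intro hausdorff_content_finite_cover[where C = C]) (auto simp: C_def)
    also have "card I = (2 * N + 1) ^ d" by (simp add: I_def card_PiE nat_add_distrib nat_mult_distrib)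
    also have "of_nat ((2 * N + 1) ^ d) * ennreal (r powr ?s) = ennreal (((2 * real N + 1) * r) ^ d)"
      unfolding ennreal_of_nat_eq_real_of_nat using r N0 assms
      by (simp add: power_mult_distrib powr_realpow' ennreal_mult' add.commute)
    also have "\<dots> \<le> ennreal ((3 * real d) ^ d)"
    proof (intro ennreal_leI power_mono)
      have "1 \<le> real N" using N0 by simp
      then have "(2 * real N + 1) * r \<le> (3 * real N) * r"
        using r by (intro mult_right_mono) auto
      then show "(2 * real N + 1) * r \<le> 3 * real d"
        using N0 by (simp add: r_def)
      show "0 \<le> (2 * real N + 1) * r" using r by simp
    qed
    finally show ?thesis .
  qed
  then have "hausdorff_measure ?m ?s ?E \<le> ennreal ((3 * real d) ^ d)"
    unfolding hausdorff_measure_def by (intro SUP_least) auto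
  then show ?thesis by (simp add: order_le_less_trans)
qed

text \<open>A set of diameter \<open>r\<close> lies in a cube of side \<open>2 r\<close> around any of its points, so comparison with
  Lebesgue measure bounds the volume of the box by \<open>2\<^sup>d\<close> times the cost of any cover.\<close>

lemma hausdorff_measure_box_pos:
  fixes a b :: "nat \<Rightarrow> real"
  assumes "d \<ge> 1" and ab: "\<And>i. i < d \<Longrightarrow> a i < b i"
  shows "0 < hausdorff_measure (euclidean_metric_dim d) (real d)
           {x \<in> topspace (Euclidean_space d). \<forall>i<d. a i \<le> x i \<and> x i \<le> b i}"
    (is "0 < hausdorff_measure ?m ?s ?E")
proof -
  interpret product_sigma_finite "\<lambda>_::nat. lborel :: real measure" ..
  define L where "L = Pi\<^sub>M {..<d} (\<lambda>_. lborel :: real measure)"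
  define Q where "Q = (\<Pi>\<^sub>E i\<in>{..<d}. {a i..b i})"
  have box: "(\<Pi>\<^sub>E i\<in>{..<d}. {u i..v i}) \<in> sets L" for u v :: "nat \<Rightarrow> real"
    by (auto simp: L_def intro!: sets_PiM_I_finite)
  have vol: "emeasure L (\<Pi>\<^sub>E i\<in>{..<d}. {u i..v i}) = ennreal (\<Prod>i<d. v i - u i)"
    if "\<And>i. i < d \<Longrightarrow> u i \<le> v i" for u v :: "nat \<Rightarrow> real"
    unfolding L_def using that by (subst emeasure_PiM) (auto intro!: prod_ennreal)
  have "ennreal (\<Prod>i<d. b i - a i) \<le> ennreal (2 ^ d) * (\<Sum>i. diam_powr ?m ?s (U i))"
    if U: "U \<in> delta_covers ?m 1 ?E" for U
  proof -
    define r where "r i = enn2real (mdiameter ?m (U i))" for i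
    define c where "c i = (SOME x. x \<in> U i)" for i
    define K where "K i = (if U i = {} then {} else (\<Pi>\<^sub>E j\<in>{..<d}. {c i j - r i..c i j + r i}))" for i
    have near: "\<bar>x j - c i j\<bar> \<le> r i" if "x \<in> U i" "j < d" for x i j
    proof -
      have "c i \<in> U i" unfolding c_def using that by (metis someI)
      moreover have "mdiameter ?m (U i) \<le> ennreal 1" using U by (auto simp: delta_covers_def)
      then have "mdiameter ?m (U i) < \<infinity>" by (rule order_le_less_trans) simp
      ultimately have "mdist ?m x (c i) \<le> r i"
        unfolding r_def using that by (intro mdist_le_mdiameter)
      then show ?thesis using abs_diff_le_L2_set[OF \<open>j < d\<close>, of x "c i"] by simp
    qed
    have sub: "Q \<subseteq> (\<Union>i. K i)"
    proof
      fix y assume y: "y \<in> Q"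
      define x where "x j = (if j < d then y j else 0)" for j
      have "x \<in> ?E" using y by (auto simp: x_def Q_def topspace_Euclidean_space PiE_iff)
      then obtain i where i: "x \<in> U i" using U by (auto simp: delta_covers_def)
      have "c i j - r i \<le> y j \<and> y j \<le> c i j + r i" if "j < d" for j
        using near[OF i that] that by (auto simp: x_def)
      then have "y \<in> K i" using y i by (auto simp: K_def Q_def PiE_iff)
      then show "y \<in> (\<Union>i. K i)" by blast
    qed
    have K: "K i \<in> sets L" for i using box by (auto simp: K_def)
    have vK: "emeasure L (K i) = ennreal (2 ^ d) * diam_powr ?m ?s (U i)" for i
    proof (cases "U i = {}")
      case False
      have "emeasure L (K i) = ennreal ((2 * r i) ^ d)"
        using False by (simp add: K_def vol r_def)
      also have "\<dots> = ennreal (2 ^ d) * diam_powr ?m ?s (U i)"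
        using False \<open>d \<ge> 1\<close>
        by (simp add: diam_powr_def power_mult_distrib ennreal_mult' r_def powr_realpow')
      finally show ?thesis .
    qed (simp add: K_def)
    have "ennreal (\<Prod>i<d. b i - a i) = emeasure L Q"
      unfolding Q_def using ab by (subst vol) (auto intro: less_imp_le)
    also have "\<dots> \<le> emeasure L (\<Union>i. K i)"
      using K sub by (intro emeasure_mono) auto
    also have "\<dots> \<le> (\<Sum>i. emeasure L (K i))"
      using K by (intro emeasure_subadditive_countably) auto
    finally show ?thesis by (simp add: vK)
  qed
  then have cost: "ennreal (\<Prod>i<d. b i - a i) / ennreal (2 ^ d) \<le> (\<Sum>i. diam_powr ?m ?s (U i))"
    if "U \<in> delta_covers ?m 1 ?E" for U
    using that by (intro divide_le_posI_ennreal) auto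
  have "0 < (\<Prod>i<d. b i - a i)" using ab by (intro prod_pos) auto
  then have "0 < ennreal (\<Prod>i<d. b i - a i) / ennreal (2 ^ d)"
    by (subst divide_ennreal) auto
  also have "\<dots> \<le> hausdorff_content ?m ?s 1 ?E"
    unfolding hausdorff_content_def by (intro INF_greatest cost)
  also have "\<dots> \<le> hausdorff_measure ?m ?s ?E" by (rule hausdorff_content_le_measure) simp
  finally show ?thesis .
qed


section \<open>Entries of powers of nonnegative matrices\<close>

lemma pow_mat_0_index:
  fixes A :: "real mat"
  assumes "A \<in> carrier_mat n n" "i < n" "j < n"
  shows "(A ^\<^sub>m 0) $$ (i, j) = (if i = j then 1 else 0)"
  using assms by simp

lemma pow_mat_Suc_index:
  fixes A :: "real mat"
  assumes "A \<in> carrier_mat n n" "i < n" "j < n"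
  shows "(A ^\<^sub>m Suc m) $$ (i, j) = (\<Sum>l<n. (A ^\<^sub>m m) $$ (i, l) * A $$ (l, j))"
  using assms by (auto simp: scalar_prod_def atLeast0LessThan intro!: sum.cong)

lemma nonneg_matrices_carrier: "A \<in> nonneg_matrices n \<Longrightarrow> A \<in> carrier_mat n n"
  by (simp add: nonneg_matrices_def)

lemma nonneg_matrices_entry: "A \<in> nonneg_matrices n \<Longrightarrow> i < n \<Longrightarrow> j < n \<Longrightarrow> 0 \<le> A $$ (i, j)"
  by (simp add: nonneg_matrices_def)

lemma pow_mat_nonneg:
  assumes "A \<in> nonneg_matrices n" "i < n" "j < n"
  shows "0 \<le> (A ^\<^sub>m m) $$ (i, j)"
  using assms(3)
proof (induction m arbitrary: j)
  case 0
  then show ?case using assms pow_mat_0_index[OF nonneg_matrices_carrier, of A n i j] by simp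
next
  case (Suc m)
  then show ?case
    unfolding pow_mat_Suc_index[OF nonneg_matrices_carrier[OF assms(1)] assms(2) Suc.prems]
    using assms by (intro sum_nonneg mult_nonneg_nonneg) (auto simp: nonneg_matrices_entry)
qed

text \<open>Concatenating a walk from \<open>i\<close> to \<open>l\<close> with one from \<open>l\<close> to \<open>j\<close> gives just those walks from
  \<open>i\<close> to \<open>j\<close> that are at \<open>l\<close> after \<open>s\<close> steps; the weights of the others are nonnegative.\<close>

lemma pow_mat_supermult:
  assumes A: "A \<in> nonneg_matrices n" and "i < n" "l < n" "j < n"
  shows "(A ^\<^sub>m s) $$ (i, l) * (A ^\<^sub>m t) $$ (l, j) \<le> (A ^\<^sub>m (s + t)) $$ (i, j)"
  using \<open>j < n\<close>
proof (induction t arbitrary: j)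
  case 0
  then show ?case
    using pow_mat_0_index[OF nonneg_matrices_carrier[OF A] \<open>l < n\<close> 0] pow_mat_nonneg[OF A \<open>i < n\<close> 0]
    by (simp del: pow_mat.simps)
next
  case (Suc t)
  note idx = pow_mat_Suc_index[OF nonneg_matrices_carrier[OF A] _ Suc.prems]
  have "(A ^\<^sub>m s) $$ (i, l) * (A ^\<^sub>m Suc t) $$ (l, j)
      = (\<Sum>q<n. (A ^\<^sub>m s) $$ (i, l) * (A ^\<^sub>m t) $$ (l, q) * A $$ (q, j))"
    unfolding idx[OF \<open>l < n\<close>] by (simp add: sum_distrib_left mult.assoc)
  also have "\<dots> \<le> (\<Sum>q<n. (A ^\<^sub>m (s + t)) $$ (i, q) * A $$ (q, j))"
    using Suc A by (intro sum_mono mult_right_mono) (auto simp: nonneg_matrices_entry)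
  also have "\<dots> = (A ^\<^sub>m Suc (s + t)) $$ (i, j)"
    unfolding idx[OF \<open>i < n\<close>] ..
  finally show ?case by simp
qed

lemma walk_weight_le_pow_mat:
  assumes A: "A \<in> nonneg_matrices n" and v: "\<And>l. l \<le> b \<Longrightarrow> v l < n" and "a \<le> b"
  shows "(\<Prod>l=a..<b. A $$ (v l, v (Suc l))) \<le> (A ^\<^sub>m (b - a)) $$ (v a, v b)"
  using \<open>a \<le> b\<close> v
proof (induction b rule: dec_induct)
  case base
  then show ?case using pow_mat_0_index[OF nonneg_matrices_carrier[OF A], of "v a" "v a"] by simp
next
  case (step b)
  note lt = step.prems[of a] step.prems[of b] step.prems[of "Suc b"]
  have "(\<Prod>l=a..<Suc b. A $$ (v l, v (Suc l)))
      \<le> (A ^\<^sub>m (b - a)) $$ (v a, v b) * A $$ (v b, v (Suc b))"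
    using step lt A by (auto intro!: mult_right_mono simp: nonneg_matrices_entry)
  also have "\<dots> \<le> (\<Sum>l<n. (A ^\<^sub>m (b - a)) $$ (v a, l) * A $$ (l, v (Suc b)))"
    using step.hyps lt A pow_mat_nonneg[OF A]
    by (intro member_le_sum) (auto simp: nonneg_matrices_entry)
  also have "\<dots> = (A ^\<^sub>m Suc (b - a)) $$ (v a, v (Suc b))"
    using step.hyps lt by (intro pow_mat_Suc_index[OF nonneg_matrices_carrier[OF A], symmetric]) auto
  finally show ?case using step.hyps by (simp add: Suc_diff_le del: pow_mat.simps)
qed

text \<open>An entry of \<open>A\<^sup>m\<close> is a sum of at most \<open>n\<^sup>m\<close> walk weights, so one of them is at least the entry
  divided by \<open>n\<^sup>m\<close>. Such a walk is built greedily, backwards from \<open>j\<close>: the largest of the \<open>n\<close> summands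
  in the last matrix product loses only a factor \<open>n\<close>. Positivity of the entry excludes the
  case \<open>m = 0\<close>, \<open>i \<noteq> j\<close>, where there is no walk at all.\<close>

lemma exists_heavy_walk:
  assumes A: "A \<in> nonneg_matrices n" and "i < n" "j < n" "0 < (A ^\<^sub>m m) $$ (i, j)"
  shows "\<exists>v. (\<forall>l\<le>m. v l < n) \<and> v 0 = i \<and> v m = j \<and>
    (A ^\<^sub>m m) $$ (i, j) \<le> real n ^ m * (\<Prod>l=0..<m. A $$ (v l, v (Suc l)))"
  using assms(3,4)
proof (induction m arbitrary: j)
  case 0
  then have "i = j"
    using pow_mat_0_index[OF nonneg_matrices_carrier[OF A] \<open>i < n\<close> 0(1)] by (auto split: if_splits)
  then show ?case
    using \<open>i < n\<close> pow_mat_0_index[OF nonneg_matrices_carrier[OF A], of i i]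
    by (intro exI[of _ "\<lambda>_. i"]) auto
next
  case (Suc m)
  define f where "f l = (A ^\<^sub>m m) $$ (i, l) * A $$ (l, j)" for l
  have S: "(A ^\<^sub>m Suc m) $$ (i, j) = (\<Sum>l<n. f l)"
    unfolding f_def using A \<open>i < n\<close> Suc.prems by (intro pow_mat_Suc_index nonneg_matrices_carrier)
  obtain q where q: "q < n" "\<And>l. l < n \<Longrightarrow> f l \<le> f q"
  proof -
    have ne: "f ` {..<n} \<noteq> {}" "finite (f ` {..<n})" using \<open>i < n\<close> by auto
    from Max_in[OF ne(2,1)] obtain q where "q < n" "f q = Max (f ` {..<n})" by auto
    then show thesis using that[of q] by (metis Max_ge ne(2) imageI lessThan_iff)
  qed
  have le: "(A ^\<^sub>m Suc m) $$ (i, j) \<le> real n * f q"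
    unfolding S using sum_bounded_above[of "{..<n}" f "f q"] q by simp
  then have "0 < f q" using Suc.prems(2) by (smt (verit) mult_nonneg_nonpos of_nat_0_le_iff)
  then have "0 < (A ^\<^sub>m m) $$ (i, q)"
    using pow_mat_nonneg[OF A \<open>i < n\<close> q(1), of m] unfolding f_def
    by (metis less_eq_real_def mult_zero_left order_less_irrefl)
  from Suc.IH[OF q(1) this] obtain v where v: "\<forall>l\<le>m. v l < n" "v 0 = i" "v m = q"
    "(A ^\<^sub>m m) $$ (i, q) \<le> real n ^ m * (\<Prod>l=0..<m. A $$ (v l, v (Suc l)))" by blast
  define w where "w = v(Suc m := j)"
  have "f q \<le> real n ^ m * (\<Prod>l=0..<m. A $$ (v l, v (Suc l))) * A $$ (q, j)"
    unfolding f_def using v(4) nonneg_matrices_entry[OF A q(1) Suc.prems(1)] by (rule mult_right_mono)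
  also have "(\<Prod>l=0..<m. A $$ (v l, v (Suc l))) = (\<Prod>l=0..<m. A $$ (w l, w (Suc l)))"
    by (rule prod.cong) (auto simp: w_def)
  also have "real n ^ m * (\<Prod>l=0..<m. A $$ (w l, w (Suc l))) * A $$ (q, j)
      = real n ^ m * (\<Prod>l=0..<Suc m. A $$ (w l, w (Suc l)))"
    using v by (simp add: w_def)
  finally have "real n * f q \<le> real n * (real n ^ m * (\<Prod>l=0..<Suc m. A $$ (w l, w (Suc l))))"
    by (rule mult_left_mono) simp
  then have "(A ^\<^sub>m Suc m) $$ (i, j) \<le> real n ^ Suc m * (\<Prod>l=0..<Suc m. A $$ (w l, w (Suc l)))"
    using le by (simp only: power_Suc mult.assoc)
  moreover have "\<forall>l\<le>Suc m. w l < n" "w 0 = i" "w (Suc m) = j"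
    using v Suc.prems by (auto simp: w_def le_Suc_eq)
  ultimately show ?case by blast
qed

text \<open>The pigeonhole argument: a heavy walk with \<open>n\<close> steps decomposes into parts of weights \<open>P\<close>, \<open>C\<close> and
  \<open>R\<close>, the middle one closed. Its weight \<open>P C R\<close> is compared with the weights
  \<open>P R\<close> and \<open>P C C R\<close> of a shorter and a longer walk. The exponent \<open>2 n\<close> is reached when the whole walk is a cycle.\<close>

lemma pow_mat_dominated:
  assumes A: "A \<in> nonneg_matrices n" and "i < n" "j < n"
  shows "(A ^\<^sub>m n) $$ (i, j) \<le> real n ^ n * (\<Sum>m\<in>{..2 * n} - {n}. (A ^\<^sub>m m) $$ (i, j))"
proof (cases "0 < (A ^\<^sub>m n) $$ (i, j)")
  case False
  have "0 \<le> real n ^ n * (\<Sum>m\<in>{..2 * n} - {n}. (A ^\<^sub>m m) $$ (i, j))"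
    using pow_mat_nonneg[OF assms] by (intro mult_nonneg_nonneg sum_nonneg) auto
  then show ?thesis using False by linarith
next
  case True
  from exists_heavy_walk[OF assms True] obtain v where v: "\<And>l. l \<le> n \<Longrightarrow> v l < n" "v 0 = i" "v n = j"
    and heavy: "(A ^\<^sub>m n) $$ (i, j) \<le> real n ^ n * (\<Prod>l=0..<n. A $$ (v l, v (Suc l)))" by blast
  define wt where "wt a b = (\<Prod>l=a..<b. A $$ (v l, v (Suc l)))" for a b
  have "\<not> inj_on v {..n}"
  proof
    assume "inj_on v {..n}"
    moreover have "v ` {..n} \<subseteq> {..<n}" using v(1) by auto
    ultimately show False using card_inj_on_le[of v "{..n}" "{..<n}"] by simp
  qed
  then obtain a b where ab: "a < b" "b \<le> n" "v a = v b"
    by (auto simp: inj_on_def) (metis linorder_neqE_nat)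
  define u where "u = v a"
  define P C R where "P = wt 0 a" and "C = wt a b" and "R = wt b n"
  have u: "u < n" unfolding u_def using ab by (intro v(1)) simp
  have nn: "0 \<le> wt c d" if "d \<le> n" for c d
    unfolding wt_def using that by (intro prod_nonneg) (auto intro!: nonneg_matrices_entry[OF A] v(1))
  have PCR: "0 \<le> P" "0 \<le> C" "0 \<le> R" unfolding P_def C_def R_def using ab by (auto intro!: nn)
  have "wt 0 n = P * C * R"
    unfolding P_def C_def R_def wt_def using ab
    by (simp add: prod.atLeastLessThan_concat)
  have P: "P \<le> (A ^\<^sub>m a) $$ (i, u)" and C: "C \<le> (A ^\<^sub>m (b - a)) $$ (u, u)"
    and R: "R \<le> (A ^\<^sub>m (n - b)) $$ (u, j)"
    using walk_weight_le_pow_mat[OF A, of a v 0] walk_weight_le_pow_mat[OF A, of b v a]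
      walk_weight_le_pow_mat[OF A, of n v b] ab v
    by (auto simp: P_def C_def R_def wt_def u_def)
  have short: "P * R \<le> (A ^\<^sub>m (n - (b - a))) $$ (i, j)"
  proof -
    have "P * R \<le> (A ^\<^sub>m a) $$ (i, u) * (A ^\<^sub>m (n - b)) $$ (u, j)"
      using P R PCR by (intro mult_mono) auto
    also have "\<dots> \<le> (A ^\<^sub>m (a + (n - b))) $$ (i, j)"
      by (rule pow_mat_supermult[OF A \<open>i < n\<close> u \<open>j < n\<close>])
    also have "a + (n - b) = n - (b - a)" using ab by simp
    finally show ?thesis .
  qed
  have long: "P * C * C * R \<le> (A ^\<^sub>m (n + (b - a))) $$ (i, j)"
  proof -
    have PC: "P * C \<le> (A ^\<^sub>m b) $$ (i, u)"
    proof -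
      have "P * C \<le> (A ^\<^sub>m a) $$ (i, u) * (A ^\<^sub>m (b - a)) $$ (u, u)"
        using P C PCR by (intro mult_mono) auto
      also have "\<dots> \<le> (A ^\<^sub>m (a + (b - a))) $$ (i, u)"
        by (rule pow_mat_supermult[OF A \<open>i < n\<close> u u])
      finally show ?thesis using ab by simp
    qed
    have CR: "C * R \<le> (A ^\<^sub>m (n - a)) $$ (u, j)"
    proof -
      have "C * R \<le> (A ^\<^sub>m (b - a)) $$ (u, u) * (A ^\<^sub>m (n - b)) $$ (u, j)"
        using C R PCR by (intro mult_mono) auto
      also have "\<dots> \<le> (A ^\<^sub>m ((b - a) + (n - b))) $$ (u, j)"
        by (rule pow_mat_supermult[OF A u u \<open>j < n\<close>])
      also have "(b - a) + (n - b) = n - a" using ab by simp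
      finally show ?thesis .
    qed
    have "(P * C) * (C * R) \<le> (A ^\<^sub>m b) $$ (i, u) * (A ^\<^sub>m (n - a)) $$ (u, j)"
      using PC CR PCR \<open>i < n\<close> u by (intro mult_mono) (auto simp: pow_mat_nonneg[OF A])
    also have "\<dots> \<le> (A ^\<^sub>m (b + (n - a))) $$ (i, j)"
      by (rule pow_mat_supermult[OF A \<open>i < n\<close> u \<open>j < n\<close>])
    also have "b + (n - a) = n + (b - a)" using ab by simp
    finally show ?thesis by (simp add: mult.assoc)
  qed
  have "C \<le> 1 + C * C"
    using zero_le_square[of "C - 1"] PCR by (simp add: algebra_simps)
  then have "P * R * C \<le> P * R * (1 + C * C)" using PCR by (intro mult_left_mono) auto
  then have "wt 0 n \<le> P * R + P * C * C * R"
    by (simp add: \<open>wt 0 n = P * C * R\<close> algebra_simps)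
  also have "\<dots> \<le> (\<Sum>m\<in>{n - (b - a), n + (b - a)}. (A ^\<^sub>m m) $$ (i, j))"
    using short long ab by simp
  also have "\<dots> \<le> (\<Sum>m\<in>{..2 * n} - {n}. (A ^\<^sub>m m) $$ (i, j))"
    using ab pow_mat_nonneg[OF assms] by (intro sum_mono2) auto
  finally have "real n ^ n * wt 0 n \<le> real n ^ n * (\<Sum>m\<in>{..2 * n} - {n}. (A ^\<^sub>m m) $$ (i, j))"
    by (intro mult_left_mono) auto
  then show ?thesis using heavy by (simp add: wt_def)
qed


section \<open>Polynomials preserving nonnegativity\<close>

lemma poly_mat_index:
  assumes "A \<in> carrier_mat n n" "degree p \<le> k" "i < n" "j < n"
  shows "poly_mat p A $$ (i, j) = (\<Sum>m\<le>k. coeff p m * (A ^\<^sub>m m) $$ (i, j))"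
proof -
  have "poly_mat p A $$ (i, j) = (\<Sum>m\<le>degree p. coeff p m * (A ^\<^sub>m m) $$ (i, j))"
    using assms by (simp add: poly_mat_def)
  also have "\<dots> = (\<Sum>m\<le>k. coeff p m * (A ^\<^sub>m m) $$ (i, j))"
    using assms by (intro sum.mono_neutral_left) (auto simp: coeff_eq_0)
  finally show ?thesis .
qed

lemma preservers_iff:
  assumes "degree p \<le> k"
  shows "p \<in> preservers n \<longleftrightarrow> (\<forall>A\<in>nonneg_matrices n. \<forall>i<n. \<forall>j<n.
    0 \<le> (\<Sum>m\<le>k. coeff p m * (A ^\<^sub>m m) $$ (i, j)))"
proof -
  have "poly_mat p A \<in> nonneg_matrices n \<longleftrightarrow>
      (\<forall>i<n. \<forall>j<n. 0 \<le> (\<Sum>m\<le>k. coeff p m * (A ^\<^sub>m m) $$ (i, j)))"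
    if "A \<in> nonneg_matrices n" for A
  proof -
    have A: "A \<in> carrier_mat n n" using that by (rule nonneg_matrices_carrier)
    then have "poly_mat p A \<in> carrier_mat n n" by (auto simp: poly_mat_def)
    then show ?thesis using poly_mat_index[OF A assms] by (auto simp: nonneg_matrices_def)
  qed
  then show ?thesis by (simp add: preservers_def)
qed

lemma preservers_Suc_subset: "preservers (Suc n) \<subseteq> preservers n"
proof
  fix p assume p: "p \<in> preservers (Suc n)"
  show "p \<in> preservers n"
    unfolding preservers_iff[OF order_refl]
  proof (intro ballI allI impI)
    fix A i j assume A: "A \<in> nonneg_matrices n" and ij: "i < n" "j < n"
    define B :: "real mat" where
      "B = mat (Suc n) (Suc n) (\<lambda>(i, j). if i < n \<and> j < n then A $$ (i, j) else 0)"
    have B: "B \<in> nonneg_matrices (Suc n)"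
      using A by (auto simp: nonneg_matrices_def B_def)
    have "(B ^\<^sub>m m) $$ (i, l) = (A ^\<^sub>m m) $$ (i, l)" if "l < n" for m l
      using that
    proof (induction m arbitrary: l)
      case 0
      then show ?case
        using ij pow_mat_0_index[OF nonneg_matrices_carrier[OF A], of i l]
          pow_mat_0_index[OF nonneg_matrices_carrier[OF B], of i l] by (simp del: pow_mat.simps)
    next
      case (Suc m)
      have "(B ^\<^sub>m Suc m) $$ (i, l) = (\<Sum>q<Suc n. (B ^\<^sub>m m) $$ (i, q) * B $$ (q, l))"
        using ij Suc.prems by (intro pow_mat_Suc_index nonneg_matrices_carrier B) auto
      also have "\<dots> = (\<Sum>q<n. (A ^\<^sub>m m) $$ (i, q) * A $$ (q, l))"
        using Suc by (simp add: B_def)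
      also have "\<dots> = (A ^\<^sub>m Suc m) $$ (i, l)"
        using ij Suc.prems by (intro pow_mat_Suc_index[symmetric] nonneg_matrices_carrier A) auto
      finally show ?case .
    qed
    moreover have "0 \<le> (\<Sum>m\<le>degree p. coeff p m * (B ^\<^sub>m m) $$ (i, j))"
      using p B ij unfolding preservers_iff[OF order_refl] by auto
    ultimately show "0 \<le> (\<Sum>m\<le>degree p. coeff p m * (A ^\<^sub>m m) $$ (i, j))"
      using ij by simp
  qed
qed

text \<open>The \<open>m\<close>-th power of the nilpotent shift has the first row \<open>e\<^sub>m\<close>, which is zero for \<open>m > n\<close>; thus the
  first row of \<open>p(N)\<close> lists the coefficients of \<open>p\<close> up to the \<open>n\<close>-th.\<close>

lemma preservers_coeff_nonneg:
  assumes "p \<in> preservers (Suc n)"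
  shows "0 \<le> coeff p n"
proof -
  define N :: "real mat" where "N = mat (Suc n) (Suc n) (\<lambda>(i, j). if j = Suc i then 1 else 0)"
  have N: "N \<in> nonneg_matrices (Suc n)" by (auto simp: N_def nonneg_matrices_def)
  note Nc = nonneg_matrices_carrier[OF N]
  have pow: "(N ^\<^sub>m m) $$ (0, j) = (if j = m then 1 else 0)" if "j < Suc n" for m j
    using that
  proof (induction m arbitrary: j)
    case 0
    then show ?case using pow_mat_0_index[OF Nc, of 0 j] by (auto simp del: pow_mat.simps)
  next
    case (Suc m)
    have "(N ^\<^sub>m Suc m) $$ (0, j) = (\<Sum>l<Suc n. (N ^\<^sub>m m) $$ (0, l) * N $$ (l, j))"
      using Suc.prems by (intro pow_mat_Suc_index Nc) auto
    also have "\<dots> = (\<Sum>l<Suc n. if l = m then (if j = Suc m then 1 else 0) else 0)"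
      using Suc by (intro sum.cong) (auto simp: N_def)
    also have "\<dots> = (if j = Suc m then 1 else 0)" using Suc.prems by (auto simp: sum.delta)
    finally show ?case .
  qed
  \<comment> \<open>The maximum keeps the index \<open>n\<close> inside the range of summation when the degree is small.\<close>
  have "degree p \<le> max (degree p) n" by simp
  from assms[unfolded preservers_iff[OF this]] N
  have "0 \<le> (\<Sum>m\<le>max (degree p) n. coeff p m * (N ^\<^sub>m m) $$ (0, n))" by auto
  also have "\<dots> = (\<Sum>m\<le>max (degree p) n. if m = n then coeff p n else 0)"
    by (intro sum.cong) (auto simp: pow)
  also have "\<dots> = coeff p n" by (simp add: sum.delta)
  finally show ?thesis .
qed

lemma preserver_with_negative_coeff:
  assumes k: "degree p \<le> k" "2 * n \<le> k" and "0 \<le> \<eta>"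
    and large: "\<And>m. m \<le> k \<Longrightarrow> m \<noteq> n \<Longrightarrow> \<eta> \<le> coeff p m"
    and neg: "- (\<eta> / real n ^ n) \<le> coeff p n"
  shows "p \<in> preservers n"
  unfolding preservers_iff[OF k(1)]
proof (intro ballI allI impI)
  fix A i j assume A: "A \<in> nonneg_matrices n" and ij: "i < n" "j < n"
  define e where "e m = (A ^\<^sub>m m) $$ (i, j)" for m
  have e: "0 \<le> e m" for m unfolding e_def by (rule pow_mat_nonneg[OF A ij])
  have pos: "0 < real n ^ n" using ij by simp
  have "e n / real n ^ n \<le> (\<Sum>m\<in>{..2 * n} - {n}. e m)"
    using pow_mat_dominated[OF A ij] pos by (simp add: e_def field_simps)
  also have "\<dots> \<le> (\<Sum>m\<in>{..k} - {n}. e m)"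
    using k e by (intro sum_mono2) auto
  finally have "\<eta> * (e n / real n ^ n) \<le> \<eta> * (\<Sum>m\<in>{..k} - {n}. e m)"
    using \<open>0 \<le> \<eta>\<close> by (rule mult_left_mono)
  also have "\<dots> \<le> (\<Sum>m\<in>{..k} - {n}. coeff p m * e m)"
    unfolding sum_distrib_left using large e by (intro sum_mono mult_right_mono) auto
  finally have "\<eta> / real n ^ n * e n \<le> (\<Sum>m\<in>{..k} - {n}. coeff p m * e m)" by simp
  moreover have "- (\<eta> / real n ^ n) * e n \<le> coeff p n * e n"
    using neg e by (rule mult_right_mono)
  moreover have "(\<Sum>m\<le>k. coeff p m * e m) = coeff p n * e n + (\<Sum>m\<in>{..k} - {n}. coeff p m * e m)"
    using k by (intro sum.remove) auto
  ultimately show "0 \<le> (\<Sum>m\<le>k. coeff p m * (A ^\<^sub>m m) $$ (i, j))"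
    unfolding e_def by simp
qed

lemma vector_is_coeff:
  fixes x :: "nat \<Rightarrow> real"
  assumes "x \<in> topspace (Euclidean_space (Suc k))"
  obtains p where "coeff p = x" "degree p \<le> k"
proof
  have "\<forall>\<^sub>\<infinity>i. x i = 0"
    using assms by (auto simp: topspace_Euclidean_space MOST_nat intro!: exI[of _ k])
  then show "coeff (Abs_poly x) = x" by (rule Abs_poly_inverse[unfolded mem_Collect_eq])
  then show "degree (Abs_poly x) \<le> k"
    using assms by (intro degree_le) (auto simp: topspace_Euclidean_space)
qed

theorem theorem5p6:
  fixes n k :: nat
  assumes "n \<ge> 1" and "k \<ge> 1" and "k \<ge> 2 * n"
  shows "hausdorff_measure (euclidean_metric_dim (k + 1)) (real (k + 1))
           (coeff ` preservers_deg (n + 1) k \<inter> mcball_of (euclidean_metric_dim (k + 1)) (\<lambda>_. 0) 1)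
       < hausdorff_measure (euclidean_metric_dim (k + 1)) (real (k + 1))
           (coeff ` preservers_deg n k \<inter> mcball_of (euclidean_metric_dim (k + 1)) (\<lambda>_. 0) 1)"
    (is "hausdorff_measure ?m ?s ?E' < hausdorff_measure ?m ?s ?E")
proof -
  \<comment> \<open>The \<open>k + 1\<close> coordinates will be at most \<open>2 * \<eta>\<close> in absolute value, hence sum to at most 1,
    and the Euclidean norm does not exceed that sum.\<close>
  define \<eta> where "\<eta> = 1 / (2 * real (k + 1))"
  \<comment> \<open>The coordinate \<open>n\<close> ranges over \<open>{- 2 * \<gamma>..- \<gamma>}\<close>: down to what
    \<open>preserver_with_negative_coeff\<close> permits, and bounded away from zero.\<close>
  define \<gamma> where "\<gamma> = \<eta> / (2 * real n ^ n)"
  have \<eta>: "0 < \<eta>" by (simp add: \<eta>_def)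
  have n1: "1 \<le> real n ^ n" using assms(1) by simp
  have \<gamma>: "0 < \<gamma>" "2 * \<gamma> = \<eta> / real n ^ n" using \<eta> n1 assms(1) by (auto simp: \<gamma>_def)
  have \<gamma>\<eta>: "\<gamma> \<le> \<eta>" using mult_left_mono[of 1 "2 * real n ^ n" \<eta>] \<eta> n1 by (simp add: \<gamma>_def divide_le_eq)
  define a where "a i = (if i = n then - 2 * \<gamma> else \<eta>)" for i
  define b where "b i = (if i = n then - \<gamma> else 2 * \<eta>)" for i
  define G where "G = {x \<in> topspace (Euclidean_space (k + 1)). \<forall>i<k + 1. a i \<le> x i \<and> x i \<le> b i}"
  have GE: "G \<subseteq> ?E"
  proof
    fix x assume x: "x \<in> G"
    then obtain p where p: "coeff p = x" "degree p \<le> k"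
      using vector_is_coeff[of x k] by (auto simp: G_def)
    have "p \<in> preservers n"
      using p x assms \<eta> \<gamma>
      by (intro preserver_with_negative_coeff[where \<eta> = \<eta> and k = k])
        (auto simp: G_def a_def b_def split: if_splits)
    moreover have "x \<in> mcball_of ?m (\<lambda>_. 0) 1"
    proof -
      have "\<bar>x i\<bar> \<le> 2 * \<eta>" if "i < k + 1" for i
      proof -
        have "a i \<le> x i \<and> x i \<le> b i" using x that by (auto simp: G_def)
        then show ?thesis using \<gamma>(1) \<gamma>\<eta> by (auto simp: a_def b_def split: if_splits)
      qed
      then have "(\<Sum>i<k + 1. \<bar>x i\<bar>) \<le> (\<Sum>i<k + 1. 2 * \<eta>)" by (intro sum_mono) auto
      also have "\<dots> = 1" by (simp add: \<eta>_def)
      finally have "L2_set x {..<k + 1} \<le> 1"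
        using L2_set_le_sum_abs[of x "{..<k + 1}"] by linarith
      then have "L2_set (\<lambda>i. 0 - x i) {..<k + 1} \<le> 1" by (simp add: L2_set_def)
      then show ?thesis using x by (simp add: G_def topspace_Euclidean_space)
    qed
    ultimately show "x \<in> ?E" using p by (auto simp: preservers_deg_def)
  qed
  have E'E: "?E' \<subseteq> ?E"
    using preservers_Suc_subset[of n] by (auto simp: preservers_deg_def)
  have gap: "\<gamma> \<le> mdist ?m x y" if "x \<in> ?E'" "y \<in> G" for x y
  proof -
    have "0 \<le> x n" using that(1) preservers_coeff_nonneg by (auto simp: preservers_deg_def)
    moreover have "y n \<le> - \<gamma>" using that(2) assms by (auto simp: G_def b_def dest: spec[of _ n])
    ultimately have "\<gamma> \<le> \<bar>x n - y n\<bar>" by simp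
    also have "\<dots> \<le> mdist ?m x y"
      unfolding mdist_euclidean_metric_dim using assms by (intro abs_diff_le_L2_set) simp
    finally show ?thesis .
  qed
  have fin: "hausdorff_measure ?m ?s ?E' < \<infinity>"
  proof -
    have "?E' \<subseteq> {x \<in> topspace (Euclidean_space (k + 1)). \<forall>i<k + 1. \<bar>x i\<bar> \<le> 1}"
    proof
      fix x assume "x \<in> ?E'"
      then have x: "x \<in> topspace (Euclidean_space (k + 1))" "L2_set (\<lambda>i. 0 - x i) {..<k + 1} \<le> 1"
        by auto
      have "\<bar>x i\<bar> \<le> 1" if "i < k + 1" for i
        using abs_diff_le_L2_set[OF that, of "\<lambda>_. 0" x] x(2) by linarith
      then show "x \<in> {x \<in> topspace (Euclidean_space (k + 1)). \<forall>i<k + 1. \<bar>x i\<bar> \<le> 1}"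
        using x by blast
    qed
    then show ?thesis
      by (rule order_le_less_trans[OF hausdorff_measure_mono hausdorff_measure_cube_finite]) simp
  qed
  have pos: "0 < hausdorff_measure ?m ?s G"
    unfolding G_def using \<eta> \<gamma> by (intro hausdorff_measure_box_pos) (auto simp: a_def b_def)
  have "hausdorff_measure ?m ?s ?E' < hausdorff_measure ?m ?s ?E' + hausdorff_measure ?m ?s G"
    using fin pos ennreal_add_left_cancel_less[of "hausdorff_measure ?m ?s ?E'" 0 "hausdorff_measure ?m ?s G"]
    by (simp only: add_0_right infinity_ennreal_def) simp
  also have "\<dots> \<le> hausdorff_measure ?m ?s (?E' \<union> G)"
    using gap \<gamma>(1) by (rule hausdorff_measure_separated)
  also have "\<dots> \<le> hausdorff_measure ?m ?s ?E"
    using E'E GE by (intro hausdorff_measure_mono) blast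
  finally show ?thesis .
qed

end
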